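(* Let $C\subset\mathbb{M}$ be a nonempty closed convex set such that $\sigma+pI\in C$ for all $\sigma\in C$ and $p\in\mathbb{R}$. Let $\varepsilon,\varepsilon^{e},\varepsilon^{p},\sigma:[0,T)\to\mathbb{M}$ be differentiable functions of time $t$ (at a fixed material point). The following two statements are equivalent. (1) For all $t\in[0,T)$: (i) (additive decomposition) $\dot\varepsilon=\dot\varepsilon^{e}+\dot\varepsilon^{p}$; (ii) (yield criterion) $\sigma\in C$, and $\dot\varepsilon^{p}=0$ whenever $\sigma$ is in the interior of $C$; (iii) (Hooke's law) $\dot\sigma=\mathbb{H}(\dot\varepsilon^{e})$; (iv) (maximum work) if $\sigma\in\partial C$, then $\dot\varepsilon^{p}:\sigma\ge\dot\varepsilon^{p}:\sigma^\star$ for all $\sigma^\star\in C$; (v) (consistency) if $\sigma\in\partial C$, then $\dot\varepsilon^{p}:\dot\sigma=0$. (2) $\sigma(0)\in C$ and, for all $t\in[0,T)$, $$\dot\varepsilon^{e}=\Pi_{T(C,\sigma)}\dot\varepsilon,\qquad \dot\varepsilon^{p}=\Pi_{N(C,\sigma)}\dot\varepsilon,\qquad \dot\sigma=\Pi_{T(C,\sigma)}\mathbb{H}(\dot\varepsilon).$$ Moreover, when these statements are true, one also has, for all $t\in[0,T)$, $$\dot\sigma=\mathbb{H}(\dot\varepsilon)-2\mu\,\Pi_{N(C,\sigma)}\dot\varepsilon,\qquad \Pi_{N(C,\sigma)}\mathbb{H}(\dot\varepsilon)=2\mu\,\Pi_{N(C,\sigma)}\dot\varepsilon,$$ $$\dot\varepsilon^{e}:\dot\varepsilon^{p}=0,\qquad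 \|\dot\varepsilon\|^2=\|\dot\varepsilon^{e}\|^2+\|\dot\varepsilon^{p}\|^2.$$
   Context: $\mathbb{M}$ is the space of real symmetric $3\times3$ matrices with scalar product $\tau:\eta=\mathrm{tr}(\tau\eta)$ and associated (Frobenius) norm $\|\cdot\|$; $I$ is the identity matrix. A dot denotes the time derivative (right derivative at $t=0$), and $0<T$. The elasticity operator is $\mathbb{H}(\tau)=2\mu\tau+\lambda\,\mathrm{tr}(\tau)I$ for $\tau\in\mathbb{M}$, where $\lambda>0$ and $\mu>0$ are constants. For a nonempty convex set $K\subset\mathbb{M}$ and $\sigma\in\mathbb{M}$, the tangent cone is $T(K,\sigma)=\overline{\{\alpha(\eta-\sigma) : \eta\in K,\ \alpha>0\}}$ (topological closure) and the normal cone is $N(K,\sigma)=\{\eta\in\mathbb{M} : \tau:\eta\le 0 \text{ for all }\tau\in T(K,\sigma)\}$. For a nonempty closed convex set $K\subset \mathbb{M}$, $\Pi_K$ is the orthogonal projection onto $K$: $\Pi_K\tau=\arg\min_{\eta\in K}\|\tau-\eta\|$. In the claim, all functions and cones are evaluated at the same time $t$, e.g. $T(C,\sigma)=T(C,\sigma(t))$. *)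

theory Defs
  imports "HOL-Analysis.Analysis"
begin

type_synonym mat3 = "real ^ 3 ^ 3"

text \<open>The space of symmetric matrices is a linear subspace of the type of all 3x3 matrices, so interior
  and boundary of subsets of it have to be taken relative to it (topology \<open>top_of_set Sym\<close>): as
  subsets of the full matrix space they all have empty interior.\<close>

definition Sym :: "mat3 set" where
  "Sym = {\<tau>. transpose \<tau> = \<tau>}"

definition ddot :: "mat3 \<Rightarrow> mat3 \<Rightarrow> real" (infix "\<bullet>\<bullet>" 70) where
  "\<tau> \<bullet>\<bullet> \<eta> = trace (\<tau> ** \<eta>)"

text \<open>On \<open>Sym\<close> this is the library inner product, and the library norm is the Frobenius norm;
  hence \<^const>\<open>closest_point\<close> below is the orthogonal projection for this scalar product.\<close>

lemma ddot_eq_inner: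
  assumes "\<tau> \<in> Sym"
  shows "\<tau> \<bullet>\<bullet> \<eta> = \<tau> \<bullet> \<eta>"
proof -
  have sym: "\<tau> $ i $ k = \<tau> $ k $ i" for i k
    using assms by (simp add: Sym_def transpose_def vec_eq_iff)
  have "\<tau> \<bullet>\<bullet> \<eta> = (\<Sum>i\<in>UNIV. \<Sum>k\<in>UNIV. \<tau> $ i $ k * \<eta> $ k $ i)"
    by (simp add: ddot_def trace_def matrix_matrix_mult_def)
  also have "\<dots> = (\<Sum>i\<in>UNIV. \<Sum>k\<in>UNIV. \<tau> $ k $ i * \<eta> $ k $ i)"
    by (intro sum.cong refl arg_cong2[of _ _ _ _ "(*)"] sym)
  also have "\<dots> = (\<Sum>k\<in>UNIV. \<Sum>i\<in>UNIV. \<tau> $ k $ i * \<eta> $ k $ i)"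
    by (rule sum.swap)
  also have "\<dots> = \<tau> \<bullet> \<eta>"
    by (simp add: inner_vec_def)
  finally show ?thesis .
qed

lemma norm_eq_sqrt_ddot:
  assumes "\<tau> \<in> Sym"
  shows "norm \<tau> = sqrt (\<tau> \<bullet>\<bullet> \<tau>)"
  by (simp add: ddot_eq_inner[OF assms] norm_eq_sqrt_inner)

definition elasticity :: "real \<Rightarrow> real \<Rightarrow> mat3 \<Rightarrow> mat3" where
  "elasticity lam \<mu> \<tau> = (2 * \<mu>) *\<^sub>R \<tau> + (lam * trace \<tau>) *\<^sub>R mat 1"

text \<open>The base point \<open>\<sigma>\<close> of the two cones is not required to lie in \<open>K\<close>.\<close>

definition tangent_cone :: "mat3 set \<Rightarrow> mat3 \<Rightarrow> mat3 set" where
  "tangent_cone K \<sigma> = closure {\<alpha> *\<^sub>R (\<eta> - \<sigma>) |\<alpha> \<eta>. \<eta> \<in> K \<and> \<alpha> > 0}"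

definition normal_cone :: "mat3 set \<Rightarrow> mat3 \<Rightarrow> mat3 set" where
  "normal_cone K \<sigma> = {\<eta> \<in> Sym. \<forall>\<tau> \<in> tangent_cone K \<sigma>. \<tau> \<bullet>\<bullet> \<eta> \<le> 0}"

text \<open>Derivative of a function on \<open>{0..<T}\<close>; taken within that interval, it is the usual two-sided
  derivative for \<open>t > 0\<close> and the right derivative at \<open>t = 0\<close>.\<close>

definition time_deriv :: "real \<Rightarrow> (real \<Rightarrow> mat3) \<Rightarrow> real \<Rightarrow> mat3" where
  "time_deriv T f t = vector_derivative f (at t within {0..<T})"

definition elastoplastic_laws ::
  "mat3 set \<Rightarrow> real \<Rightarrow> real \<Rightarrow> real \<Rightarrow> (real \<Rightarrow> mat3) \<Rightarrow> (real \<Rightarrow> mat3) \<Rightarrow> (real \<Rightarrow> mat3) \<Rightarrow> (real \<Rightarrow> mat3) \<Rightarrow> bool"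
where
  "elastoplastic_laws C lam \<mu> T \<epsilon> \<epsilon>e \<epsilon>p \<sigma> \<longleftrightarrow>
    (\<forall>t\<in>{0..<T}.
      time_deriv T \<epsilon> t = time_deriv T \<epsilon>e t + time_deriv T \<epsilon>p t \<and>
      \<sigma> t \<in> C \<and> (\<sigma> t \<in> top_of_set Sym interior_of C \<longrightarrow> time_deriv T \<epsilon>p t = 0) \<and>
      time_deriv T \<sigma> t = elasticity lam \<mu> (time_deriv T \<epsilon>e t) \<and>
      (\<sigma> t \<in> top_of_set Sym frontier_of C \<longrightarrow>
        (\<forall>\<sigma>'\<in>C. time_deriv T \<epsilon>p t \<bullet>\<bullet> \<sigma> t \<ge> time_deriv T \<epsilon>p t \<bullet>\<bullet> \<sigma>')) \<and>
      (\<sigma> t \<in> top_of_set Sym frontier_of C \<longrightarrow> time_deriv T \<epsilon>p t \<bullet>\<bullet> time_deriv T \<sigma> t = 0))"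

definition projection_laws ::
  "mat3 set \<Rightarrow> real \<Rightarrow> real \<Rightarrow> real \<Rightarrow> (real \<Rightarrow> mat3) \<Rightarrow> (real \<Rightarrow> mat3) \<Rightarrow> (real \<Rightarrow> mat3) \<Rightarrow> (real \<Rightarrow> mat3) \<Rightarrow> bool"
where
  "projection_laws C lam \<mu> T \<epsilon> \<epsilon>e \<epsilon>p \<sigma> \<longleftrightarrow>
    \<sigma> 0 \<in> C \<and>
    (\<forall>t\<in>{0..<T}.
      time_deriv T \<epsilon>e t = closest_point (tangent_cone C (\<sigma> t)) (time_deriv T \<epsilon> t) \<and>
      time_deriv T \<epsilon>p t = closest_point (normal_cone C (\<sigma> t)) (time_deriv T \<epsilon> t) \<and>
      time_deriv T \<sigma> t =
        closest_point (tangent_cone C (\<sigma> t)) (elasticity lam \<mu> (time_deriv T \<epsilon> t)))"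

end

theory Submission
  imports Defs
begin

text \<open>Everything reduces to Moreau's decomposition of the strain rate along the polar cones
  \<open>T(C,\<sigma>)\<close> and \<open>N(C,\<sigma>)\<close>. Invariance of \<open>C\<close> under multiples of the identity puts the line spanned by the
  identity into \<open>T(C,\<sigma>)\<close>, so normal directions are trace-free, and the elasticity operator preserves
  \<open>T(C,\<sigma>)\<close> in both directions while acting as \<open>2\<mu>\<close> on \<open>N(C,\<sigma>)\<close>; it therefore maps one Moreau decomposition
  to another. That the projection laws keep \<open>\<sigma>\<close> inside \<open>C\<close> is a viability statement: the tangent cone
  at a point outside \<open>C\<close> contains only directions along which the distance to \<open>C\<close> does not increase.\<close>

section \<open>Projections onto convex sets and cones\<close>

text \<open>Converse of the variational inequality \<open>closest_point_dot\<close>: expanding the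
  squared distance from \<open>x\<close> to \<open>k\<close> around \<open>a\<close>, the obtuse
  angle makes the cross term nonnegative, so no point of \<open>S\<close> beats
  \<open>a\<close>.\<close>

lemma closest_point_eqI:
  fixes S :: "'a::euclidean_space set"
  assumes "convex S" "closed S" "a \<in> S" and obtuse: "\<And>k. k \<in> S \<Longrightarrow> (x - a) \<bullet> (k - a) \<le> 0"
  shows "closest_point S x = a"
proof (rule closest_point_unique[OF assms(1-3), symmetric], rule ballI)
  fix k assume "k \<in> S"
  have "(dist x k)\<^sup>2 = (dist x a)\<^sup>2 - 2 * ((x - a) \<bullet> (k - a)) + (norm (k - a))\<^sup>2"
    by (simp add: dist_norm power2_norm_eq_inner algebra_simps inner_commute)
  then have "(dist x a)\<^sup>2 \<le> (dist x k)\<^sup>2"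
    using obtuse[OF \<open>k \<in> S\<close>] zero_le_power2[of "norm (k - a)"] by linarith
  then show "dist x a \<le> dist x k"
    by (rule power2_le_imp_le) simp
qed

text \<open>On a cone the variational inequality may be tested at 0 and at twice the projection.
  These give opposite signs for the same product, hence orthogonality, and the residual then lies in
  the polar cone.\<close>

lemma closest_point_cone:
  fixes S :: "'a::euclidean_space set"
  assumes "convex S" "closed S" "0 \<in> S"
    and scale: "\<And>c k. c > 0 \<Longrightarrow> k \<in> S \<Longrightarrow> c *\<^sub>R k \<in> S"
  shows "closest_point S x \<bullet> (x - closest_point S x) = 0"
    and "k \<in> S \<Longrightarrow> k \<bullet> (x - closest_point S x) \<le> 0"
proof -
  define a where "a = closest_point S x"
  have "a \<in> S"
    unfolding a_def using assms by (intro closest_point_in_set) auto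
  then have "2 *\<^sub>R a \<in> S"
    by (intro scale) auto
  have obtuse: "(x - a) \<bullet> (k - a) \<le> 0" if "k \<in> S" for k
    unfolding a_def by (rule closest_point_dot[OF assms(1,2) that])
  from obtuse[OF \<open>2 *\<^sub>R a \<in> S\<close>] obtuse[OF \<open>0 \<in> S\<close>]
  have orth: "(x - a) \<bullet> a = 0"
    by (simp add: scaleR_2)
  then show "closest_point S x \<bullet> (x - closest_point S x) = 0"
    by (simp add: a_def inner_commute)
  show "k \<bullet> (x - closest_point S x) \<le> 0" if "k \<in> S"
    using obtuse[OF that] orth by (simp add: a_def inner_commute inner_diff_right)
qed

text \<open>The residual is half the gradient of the squared distance. Its monotonicity follows from
  nonexpansiveness of the projection and Cauchy-Schwarz, and stands in for convexity of the squared
  distance below.\<close>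

lemma closest_point_monotone:
  fixes S :: "'a::euclidean_space set"
  assumes "convex S" "closed S" "S \<noteq> {}"
  shows "(y - closest_point S y - (x - closest_point S x)) \<bullet> (y - x) \<ge> 0"
proof -
  have "(closest_point S y - closest_point S x) \<bullet> (y - x)
      \<le> norm (closest_point S y - closest_point S x) * norm (y - x)"
    by (rule norm_cauchy_schwarz)
  also have "\<dots> \<le> norm (y - x) * norm (y - x)"
    using closest_point_lipschitz[OF assms, of y x]
    by (intro mult_right_mono) (auto simp: dist_norm)
  also have "\<dots> = (y - x) \<bullet> (y - x)"
    by (simp add: dot_square_norm power2_eq_square)
  finally show ?thesis
    by (simp add: inner_diff_left)
qed

text \<open>The first-order error is at most quadratic on both sides, whatever the shape of the
  boundary of \<open>S\<close>. This makes the squared distance a usable Lyapunov function in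
  \<open>viability\<close>.\<close>

lemma has_derivative_dist_closest_point_squared:
  fixes S :: "'a::euclidean_space set"
  assumes "convex S" "closed S" "S \<noteq> {}"
  shows "((\<lambda>x. (dist x (closest_point S x))\<^sup>2) has_derivative
    (\<lambda>h. 2 * ((x - closest_point S x) \<bullet> h))) (at x within X)"
proof -
  define f where "f x = (dist x (closest_point S x))\<^sup>2" for x
  have upper: "f y - f x - 2 * ((x - closest_point S x) \<bullet> (y - x)) \<le> (norm (y - x))\<^sup>2" for x y
  proof -
    \<comment> \<open>The closest point of \<open>x\<close> serves as a competitor for
      \<open>y\<close>.\<close>
    have "f y \<le> (dist y (closest_point S x))\<^sup>2"
      unfolding f_def using assms
      by (intro power_mono closest_point_le closest_point_in_set) auto
    also have "\<dots> = f x + 2 * ((x - closest_point S x) \<bullet> (y - x)) + (norm (y - x))\<^sup>2"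
      by (simp add: f_def dist_norm power2_norm_eq_inner algebra_simps inner_commute)
    finally show ?thesis by simp
  qed
  have bound: "\<bar>f y - f x - 2 * ((x - closest_point S x) \<bullet> (y - x))\<bar> \<le> (norm (y - x))\<^sup>2" for y
  proof -
    \<comment> \<open>Exchanging \<open>x\<close> and \<open>y\<close> gives a lower bound that
      carries the gradient at \<open>y\<close>; monotonicity trades it for the gradient at
      \<open>x\<close>.\<close>
    have "f x - f y - 2 * ((y - closest_point S y) \<bullet> (x - y)) \<le> (norm (y - x))\<^sup>2"
      using upper[of x y] by (simp add: norm_minus_commute)
    moreover have "(y - closest_point S y) \<bullet> (x - y) \<le> - ((x - closest_point S x) \<bullet> (y - x))"
      using closest_point_monotone[OF assms, of y x] by (simp add: inner_diff_left inner_diff_right)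
    ultimately show ?thesis
      using upper[of y x] by linarith
  qed
  have "(f has_derivative (\<lambda>h. 2 * ((x - closest_point S x) \<bullet> h))) (at x within X)"
  \<comment> \<open>The quadratic bound is global, so the radius 1 is an arbitrary choice.\<close>
  proof (rule has_derivativeI_sandwich[where e = 1 and H = "\<lambda>y. norm (y - x)"])
    show "bounded_linear (\<lambda>h. 2 * ((x - closest_point S x) \<bullet> h))"
      by (intro bounded_linear_const_mult bounded_linear_inner_right)
    show "norm (f y - f x - 2 * ((x - closest_point S x) \<bullet> (y - x))) / norm (y - x) \<le> norm (y - x)"
      if "y \<noteq> x" for y
      using bound[of y] that by (simp add: divide_le_eq power2_eq_square)
    show "((\<lambda>y. norm (y - x)) \<longlongrightarrow> 0) (at x within X)"
      by (rule tendsto_eq_intros | simp)+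
  qed simp
  then show ?thesis
    unfolding f_def .
qed

section \<open>Curves in the space of matrices\<close>

text \<open>The derivative is also the limit of forward quotients alone. Only these have a positive
  factor \<open>1 / (s - t)\<close>, as membership in a tangent cone requires; at
  \<open>t = 0\<close> they are all there is.\<close>

lemma right_derivative_in_closed:
  fixes f :: "real \<Rightarrow> 'a::real_normed_vector"
  assumes der: "(f has_vector_derivative d) (at t within {0..<T})" and t: "t \<in> {0..<T}"
    and "closed K" and quot: "\<And>s. t < s \<Longrightarrow> s < T \<Longrightarrow> (1 / (s - t)) *\<^sub>R (f s - f t) \<in> K"
  shows "d \<in> K"
proof -
  have "(f has_vector_derivative d) (at t within {t<..<T})"
    using t by (intro has_vector_derivative_within_subset[OF der]) auto
  then have "((\<lambda>s. (f s - (f t + (s - t) *\<^sub>R d)) /\<^sub>R norm (s - t)) \<longlongrightarrow> 0) (at t within {t<..<T})"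
    by (simp add: has_vector_derivative_def has_derivative_within divide_inverse)
  \<comment> \<open>Adding \<open>d\<close> to the normalised remainder restores the difference
    quotient, because \<open>s - t\<close> is its own norm to the right of \<open>t\<close>.\<close>
  then have "((\<lambda>s. (f s - (f t + (s - t) *\<^sub>R d)) /\<^sub>R norm (s - t) + d) \<longlongrightarrow> 0 + d) (at t within {t<..<T})"
    by (intro tendsto_intros)
  then have lim: "((\<lambda>s. (1 / (s - t)) *\<^sub>R (f s - f t)) \<longlongrightarrow> d) (at t within {t<..<T})"
    unfolding add_0
  proof (rule Lim_transform_within[OF _ zero_less_one])
    fix s assume "s \<in> {t<..<T}"
    then have "s - t > 0" by simp
    then show "(f s - (f t + (s - t) *\<^sub>R d)) /\<^sub>R norm (s - t) + d = (1 / (s - t)) *\<^sub>R (f s - f t)"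
      by (simp add: scaleR_diff_right scaleR_add_right divide_inverse)
  qed
  show ?thesis
  proof (rule Lim_in_closed_set[OF \<open>closed K\<close> _ _ lim])
    show "\<forall>\<^sub>F s in at t within {t<..<T}. (1 / (s - t)) *\<^sub>R (f s - f t) \<in> K"
      using quot by (auto simp: eventually_at_filter)
    show "at t within {t<..<T} \<noteq> bot"
      using t by (simp add: trivial_limit_within islimpt_greaterThanLessThan1)
  qed
qed

lemma has_vector_derivative_time_deriv:
  assumes "f differentiable_on {0..<T}" "t \<in> {0..<T}"
  shows "(f has_vector_derivative time_deriv T f t) (at t within {0..<T})"
  using assms unfolding time_deriv_def differentiable_on_def
  by (simp add: vector_derivative_works)

lemma subspace_Sym: "subspace Sym"
  by (auto simp: subspace_def Sym_def transpose_def vec_eq_iff)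

lemmas Sym_intros = subspace_add[OF subspace_Sym] subspace_diff[OF subspace_Sym]
  subspace_scale[OF subspace_Sym]

lemma mat_1_in_Sym: "mat 1 \<in> Sym"
  by (simp add: Sym_def)

lemma inner_mat_1: "mat 1 \<bullet> A = trace A" for A :: mat3
  unfolding ddot_eq_inner[OF mat_1_in_Sym, symmetric] by (simp add: ddot_def)

lemma time_deriv_in_Sym:
  assumes "f \<in> {0..<T} \<rightarrow> Sym" "f differentiable_on {0..<T}" "t \<in> {0..<T}"
  shows "time_deriv T f t \<in> Sym"
  by (rule right_derivative_in_closed[OF has_vector_derivative_time_deriv[OF assms(2,3)] assms(3)])
    (use assms in \<open>auto intro!: Sym_intros closed_subspace subspace_Sym\<close>)

section \<open>Tangent and normal cones\<close>

locale convex_matrix_set =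
  fixes C :: "mat3 set"
  assumes sub_Sym: "C \<subseteq> Sym" and nonempty: "C \<noteq> {}" and convex: "convex C" and closed: "closed C"
begin

lemma closed_tangent_cone: "closed (tangent_cone C s)"
  by (simp add: tangent_cone_def)

text \<open>The base point \<open>s\<close> stays arbitrary here: \<open>viability\<close> works
  with cones at points not yet known to lie in \<open>C\<close>.\<close>

lemma tangent_coneI: "\<eta> \<in> C \<Longrightarrow> \<alpha> > 0 \<Longrightarrow> \<alpha> *\<^sub>R (\<eta> - s) \<in> tangent_cone C s"
  unfolding tangent_cone_def by (intro closure_subset[THEN subsetD]) auto

lemma diff_in_tangent_cone: "\<eta> \<in> C \<Longrightarrow> \<eta> - s \<in> tangent_cone C s"
  using tangent_coneI[of \<eta> 1 s] by simp

lemma tangent_cone_nonempty: "tangent_cone C s \<noteq> {}"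
  using nonempty diff_in_tangent_cone by blast

text \<open>Minimality of the closure: a closed condition has to be checked only on the
  generators.\<close>

lemma tangent_cone_subsetI:
  assumes "Topological_Spaces.closed K" "\<And>\<alpha> \<eta>. \<eta> \<in> C \<Longrightarrow> \<alpha> > 0 \<Longrightarrow> \<alpha> *\<^sub>R (\<eta> - s) \<in> K"
  shows "tangent_cone C s \<subseteq> K"
  unfolding tangent_cone_def using assms by (intro closure_minimal) auto

lemma tangent_cone_scale:
  assumes "c > 0" "x \<in> tangent_cone C s"
  shows "c *\<^sub>R x \<in> tangent_cone C s"
proof -
  have "c *\<^sub>R \<alpha> *\<^sub>R (\<eta> - s) \<in> tangent_cone C s" if "\<eta> \<in> C" "\<alpha> > 0" for \<alpha> \<eta>
    using tangent_coneI[OF that(1) mult_pos_pos[OF \<open>c > 0\<close> that(2)], of s] by simp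
  then have "tangent_cone C s \<subseteq> (*\<^sub>R) c -` tangent_cone C s"
    by (intro tangent_cone_subsetI continuous_closed_vimage closed_tangent_cone)
      (auto intro!: continuous_intros)
  then show ?thesis
    using assms(2) by auto
qed

text \<open>The set of generators is already convex, and closure preserves convexity. Working with
  open segments keeps both weights positive, as generators demand.\<close>

lemma convex_tangent_cone: "Convex.convex (tangent_cone C s)"
proof -
  have "Convex.convex {\<alpha> *\<^sub>R (\<eta> - s) |\<alpha> \<eta>. \<eta> \<in> C \<and> \<alpha> > 0}" (is "Convex.convex ?G")
    unfolding convex_contains_open_segment
  proof (intro ballI subsetI)
    fix x y z assume "x \<in> ?G" "y \<in> ?G" "z \<in> open_segment x y"
    then obtain \<alpha> \<eta> \<beta> \<theta> u where *: "x = \<alpha> *\<^sub>R (\<eta> - s)" "\<eta> \<in> C" "\<alpha> > 0"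
      "y = \<beta> *\<^sub>R (\<theta> - s)" "\<theta> \<in> C" "\<beta> > 0" "z = (1 - u) *\<^sub>R x + u *\<^sub>R y" "0 < u" "u < 1"
      unfolding in_segment by blast
    \<comment> \<open>These are the coefficients of \<open>\<eta> - s\<close> and
      \<open>\<theta> - s\<close> in \<open>z\<close>. Their normalised mean \<open>\<zeta>\<close>
      lies in \<open>C\<close>, so \<open>z\<close> is the single generator
      \<open>(a + b) *\<^sub>R (\<zeta> - s)\<close>.\<close>
    define a b where "a = (1 - u) * \<alpha>" and "b = u * \<beta>"
    have pos: "a > 0" "b > 0"
      using * by (auto simp: a_def b_def)
    define \<zeta> where "\<zeta> = (a / (a + b)) *\<^sub>R \<eta> + (b / (a + b)) *\<^sub>R \<theta>"
    have mem: "\<zeta> \<in> C"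
      unfolding \<zeta>_def using pos * convex
      by (intro convexD) (auto simp: add_divide_distrib[symmetric])
    have eq: "(a + b) *\<^sub>R \<zeta> = a *\<^sub>R \<eta> + b *\<^sub>R \<theta>"
      using pos by (simp add: \<zeta>_def scaleR_add_right)
    have "z = a *\<^sub>R (\<eta> - s) + b *\<^sub>R (\<theta> - s)"
      using * by (simp add: a_def b_def)
    also have "\<dots> = (a + b) *\<^sub>R (\<zeta> - s)"
      unfolding scaleR_diff_right eq by (simp add: scaleR_add_left)
    finally show "z \<in> ?G"
      using mem add_pos_pos[OF pos] by blast
  qed
  then show ?thesis
    by (simp add: tangent_cone_def convex_closure)
qed

lemma tangent_cone_add:
  assumes "x \<in> tangent_cone C s" "y \<in> tangent_cone C s"
  shows "x + y \<in> tangent_cone C s"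
proof -
  have "(1/2) *\<^sub>R x + (1/2) *\<^sub>R y \<in> tangent_cone C s"
    by (intro convexD[OF convex_tangent_cone] assms) auto
  then have "2 *\<^sub>R ((1/2) *\<^sub>R x + (1/2) *\<^sub>R y) \<in> tangent_cone C s"
    by (rule tangent_cone_scale[rotated]) simp
  also have "2 *\<^sub>R ((1/2) *\<^sub>R x + (1/2) *\<^sub>R y) = x + y"
    by (simp add: scaleR_add_right)
  finally show ?thesis .
qed

lemma tangent_cone_subset_Sym: "s \<in> Sym \<Longrightarrow> tangent_cone C s \<subseteq> Sym"
  by (rule tangent_cone_subsetI)
    (use sub_Sym in \<open>auto intro: closed_subspace[OF subspace_Sym] Sym_intros\<close>)

text \<open>A half-space through 0 is closed and stable under positive scaling, so polarity can be
  tested on \<open>C - s\<close> alone. With \<open>s\<close> symmetric the whole tangent cone is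
  symmetric, and the trace product becomes the inner product.\<close>

lemma mem_normal_cone_iff:
  assumes "s \<in> Sym"
  shows "\<eta> \<in> normal_cone C s \<longleftrightarrow> \<eta> \<in> Sym \<and> (\<forall>\<tau>\<in>C. (\<tau> - s) \<bullet> \<eta> \<le> 0)"
proof -
  have "tangent_cone C s \<subseteq> {x. x \<bullet> \<eta> \<le> 0}" if "\<forall>\<tau>\<in>C. (\<tau> - s) \<bullet> \<eta> \<le> 0"
  proof (rule tangent_cone_subsetI)
    show "Topological_Spaces.closed {x. x \<bullet> \<eta> \<le> 0}"
      using closed_halfspace_le[of \<eta> 0] by (simp add: inner_commute)
    show "\<alpha> *\<^sub>R (\<tau> - s) \<in> {x. x \<bullet> \<eta> \<le> 0}" if "\<tau> \<in> C" "\<alpha> > 0" for \<alpha> \<tau>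
      using \<open>\<forall>\<tau>\<in>C. (\<tau> - s) \<bullet> \<eta> \<le> 0\<close> that by (simp add: mult_nonneg_nonpos)
  qed
  then show ?thesis
    using diff_in_tangent_cone[of _ s] ddot_eq_inner[OF subsetD[OF tangent_cone_subset_Sym[OF assms]]]
    unfolding normal_cone_def by fastforce
qed

lemma normal_cone_inner_le:
  assumes "s \<in> Sym" "\<eta> \<in> normal_cone C s" "\<tau> \<in> tangent_cone C s"
  shows "\<tau> \<bullet> \<eta> \<le> 0"
  using assms tangent_cone_subset_Sym[OF assms(1)]
  by (auto simp: normal_cone_def ddot_eq_inner subset_iff)

text \<open>Written as a subspace cut by half-spaces, the cone is visibly closed and convex.\<close>

lemma normal_cone_altdef:
  "s \<in> Sym \<Longrightarrow> normal_cone C s = Sym \<inter> (\<Inter>\<tau>\<in>C. {\<eta>. (\<tau> - s) \<bullet> \<eta> \<le> 0})"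
  by (auto simp: mem_normal_cone_iff)

lemma closed_normal_cone: "s \<in> Sym \<Longrightarrow> Topological_Spaces.closed (normal_cone C s)"
  unfolding normal_cone_altdef
  by (intro closed_Int closed_INT ballI closed_halfspace_le closed_subspace subspace_Sym)

lemma convex_normal_cone: "s \<in> Sym \<Longrightarrow> Convex.convex (normal_cone C s)"
  unfolding normal_cone_altdef
  by (intro convex_Int convex_INT convex_halfspace_le subspace_imp_convex subspace_Sym)

lemma normal_cone_scale:
  "s \<in> Sym \<Longrightarrow> c \<ge> 0 \<Longrightarrow> \<eta> \<in> normal_cone C s \<Longrightarrow> c *\<^sub>R \<eta> \<in> normal_cone C s"
  by (auto simp: mem_normal_cone_iff Sym_intros mult_nonneg_nonpos)

text \<open>From a relatively interior point a short step along \<open>\<eta>\<close> stays in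
  \<open>C\<close>; normality tested on that step makes a positive multiple of the squared norm of
  \<open>\<eta>\<close> nonpositive.\<close>

lemma normal_cone_interior:
  assumes "s \<in> top_of_set Sym interior_of C" "\<eta> \<in> normal_cone C s"
  shows "\<eta> = 0"
proof (rule ccontr)
  assume "\<eta> \<noteq> 0"
  obtain U where U: "openin (top_of_set Sym) U" "s \<in> U" "U \<subseteq> C"
    using assms(1) by (auto simp: interior_of_def)
  then have "s \<in> Sym" using sub_Sym by blast
  have "\<eta> \<in> Sym" using assms(2) by (simp add: normal_cone_def)
  obtain e where e: "e > 0" "\<And>x. x \<in> Sym \<Longrightarrow> dist x s < e \<Longrightarrow> x \<in> C"
    using U unfolding openin_euclidean_subtopology_iff by blast
  \<comment> \<open>The step then has length \<open>e / 2\<close>, strictly below the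
    radius.\<close>
  define c where "c = e / (2 * norm \<eta>)"
  have "c > 0" using e \<open>\<eta> \<noteq> 0\<close> by (simp add: c_def)
  have "s + c *\<^sub>R \<eta> \<in> C"
    using \<open>s \<in> Sym\<close> \<open>\<eta> \<in> Sym\<close> e(1) \<open>\<eta> \<noteq> 0\<close>
    by (intro e(2) Sym_intros) (auto simp: dist_norm c_def)
  then have "(s + c *\<^sub>R \<eta> - s) \<bullet> \<eta> \<le> 0"
    using assms(2) unfolding mem_normal_cone_iff[OF \<open>s \<in> Sym\<close>] by blast
  then show False
    using \<open>c > 0\<close> \<open>\<eta> \<noteq> 0\<close>
    by (simp add: mult_le_0_iff power2_norm_eq_inner[symmetric])
qed

text \<open>Uniqueness half of Moreau's theorem: in an orthogonal splitting each summand is the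
  residual of the other and pairs nonpositively with the other's cone, which is the variational
  inequality for both projections.\<close>

lemma moreau_composition:
  assumes "s \<in> Sym" "a \<in> tangent_cone C s" "b \<in> normal_cone C s" "a \<bullet> b = 0"
  shows "closest_point (tangent_cone C s) (a + b) = a"
    and "closest_point (normal_cone C s) (a + b) = b"
proof -
  show "closest_point (tangent_cone C s) (a + b) = a"
    using normal_cone_inner_le[OF assms(1,3)] assms
    by (intro closest_point_eqI convex_tangent_cone closed_tangent_cone)
      (auto simp: inner_diff_right inner_commute)
  show "closest_point (normal_cone C s) (a + b) = b"
    using normal_cone_inner_le[OF assms(1) _ assms(2)] assms
    by (intro closest_point_eqI convex_normal_cone closed_normal_cone)
      (auto simp: inner_diff_right)
qed

text \<open>Existence half: the residual of the tangential projection is polar to the cone and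
  orthogonal to the projection, and uniqueness identifies it with the normal projection. Membership
  of \<open>s\<close> in \<open>C\<close> supplies the vertex 0.\<close>

lemma moreau_decomposition:
  assumes "s \<in> C" "x \<in> Sym"
    and "a = closest_point (tangent_cone C s) x" and "b = closest_point (normal_cone C s) x"
  shows "x = a + b" "a \<in> tangent_cone C s" "b \<in> normal_cone C s" "a \<bullet> b = 0"
proof -
  have "s \<in> Sym" using assms sub_Sym by auto
  have "0 \<in> tangent_cone C s"
    using diff_in_tangent_cone[OF assms(1), of s] by simp
  note cone = closest_point_cone[OF convex_tangent_cone closed_tangent_cone this tangent_cone_scale,
      where x = x, folded assms(3)]
  show a: "a \<in> tangent_cone C s"
    unfolding assms(3) by (intro closest_point_in_set closed_tangent_cone tangent_cone_nonempty)
  then have "x - a \<in> Sym"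
    using tangent_cone_subset_Sym[OF \<open>s \<in> Sym\<close>] assms(2) by (auto intro: Sym_intros)
  then have normal: "x - a \<in> normal_cone C s"
    using cone(2) diff_in_tangent_cone[of _ s]
    by (auto simp: mem_normal_cone_iff[OF \<open>s \<in> Sym\<close>])
  have "b = x - a"
    using moreau_composition(2)[OF \<open>s \<in> Sym\<close> a normal cone(1)] assms(4) by simp
  then show "x = a + b" "b \<in> normal_cone C s" "a \<bullet> b = 0"
    using normal cone(1) by simp_all
qed

section \<open>Viability: curves inside \<open>C\<close> and their velocities\<close>

lemma time_deriv_in_tangent_cone:
  assumes "f differentiable_on {0..<T}" "t \<in> {0..<T}" "\<And>s. s \<in> {0..<T} \<Longrightarrow> f s \<in> C"
  shows "time_deriv T f t \<in> tangent_cone C (f t)"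
proof (rule right_derivative_in_closed[OF has_vector_derivative_time_deriv[OF assms(1,2)] assms(2)])
  show "(1 / (s - t)) *\<^sub>R (f s - f t) \<in> tangent_cone C (f t)" if "t < s" "s < T" for s
    using that assms(2) by (intro tangent_coneI assms(3)) auto
qed (rule closed_tangent_cone)

text \<open>Splitting \<open>\<eta> - s\<close> at the closest point leaves the variational
  inequality and minus a square. So the gradient of the squared distance pairs nonpositively with
  every tangent direction, also when \<open>s\<close> is outside \<open>C\<close>.\<close>

lemma tangent_cone_outside:
  assumes "\<tau> \<in> tangent_cone C s"
  shows "(s - closest_point C s) \<bullet> \<tau> \<le> 0"
proof -
  have "tangent_cone C s \<subseteq> {x. (s - closest_point C s) \<bullet> x \<le> 0}"
  proof (rule tangent_cone_subsetI[OF closed_halfspace_le])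
    fix \<alpha> :: real and \<eta> assume "\<eta> \<in> C" "\<alpha> > 0"
    have "(s - closest_point C s) \<bullet> (\<eta> - s)
        = (s - closest_point C s) \<bullet> (\<eta> - closest_point C s) - (norm (s - closest_point C s))\<^sup>2"
      by (simp add: power2_norm_eq_inner algebra_simps)
    also have "\<dots> \<le> 0"
      using closest_point_dot[OF convex closed \<open>\<eta> \<in> C\<close>, of s]
        zero_le_power2[of "norm (s - closest_point C s)"] by linarith
    finally show "\<alpha> *\<^sub>R (\<eta> - s) \<in> {x. (s - closest_point C s) \<bullet> x \<le> 0}"
      using \<open>\<alpha> > 0\<close> by (simp add: mult_nonneg_nonpos)
  qed
  then show ?thesis using assms by blast
qed

text \<open>The squared distance to \<open>C\<close> along the curve starts at 0 and, by the chain
  rule and \<open>tangent_cone_outside\<close>, has nonpositive derivative; hence it stays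
  0.\<close>

lemma viability:
  assumes diff: "f differentiable_on {0..<T}" and "f 0 \<in> C"
    and tan: "\<And>t. t \<in> {0..<T} \<Longrightarrow> time_deriv T f t \<in> tangent_cone C (f t)"
    and t: "t \<in> {0..<T}"
  shows "f t \<in> C"
proof -
  define D where "D s = (dist (f s) (closest_point C (f s)))\<^sup>2" for s
  have der: "(D has_real_derivative 2 * ((f s - closest_point C (f s)) \<bullet> time_deriv T f s))
      (at s within {0..<T})" if "s \<in> {0..<T}" for s
  proof -
    have "(f has_derivative (\<lambda>h. h *\<^sub>R time_deriv T f s)) (at s within {0..<T})"
      using has_vector_derivative_time_deriv[OF diff that] by (simp add: has_vector_derivative_def)
    from has_derivative_compose[OF this
        has_derivative_dist_closest_point_squared[OF convex closed nonempty]]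
    have "(D has_derivative (\<lambda>h. 2 * ((f s - closest_point C (f s)) \<bullet> time_deriv T f s) * h))
        (at s within {0..<T})"
      unfolding D_def by (simp add: mult_ac)
    then show ?thesis
      by (simp add: has_field_derivative_def)
  qed
  have "D 0 \<ge> D t"
  proof (rule DERIV_nonpos_imp_decreasing_open[where f = D])
    show "0 \<le> t" using t by simp
    \<comment> \<open>At such times the derivative within the interval is two-sided, as the
      monotonicity criterion requires; at the ends continuity is enough.\<close>
    fix s assume s: "0 < s" "s < t"
    then have "at s within {0..<T} = at s"
      using t by (intro at_within_interior) auto
    moreover have "s \<in> {0..<T}" using s t by auto
    ultimately show "\<exists>y. DERIV D s :> y \<and> y \<le> 0"
      using der[of s] tangent_cone_outside[OF tan[of s]] by auto
  next
    have "continuous_on {0..<T} D"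
      using der by (rule DERIV_continuous_on)
    then show "continuous_on {0..t} D"
      by (rule continuous_on_subset) (use t in auto)
  qed
  moreover have "D 0 = 0"
    using \<open>f 0 \<in> C\<close> by (simp add: D_def closest_point_self)
  ultimately have "D t \<le> 0"
    by simp
  then have "f t = closest_point C (f t)"
    by (simp add: D_def)
  then show ?thesis
    using closest_point_in_set[OF closed nonempty] by metis
qed

end

section \<open>Effect of pressure invariance on the cones and on the elasticity operator\<close>

locale pressure_insensitive = convex_matrix_set +
  assumes shift: "\<tau> \<in> C \<Longrightarrow> \<tau> + p *\<^sub>R mat 1 \<in> C"
begin

lemma pressure_in_tangent_cone:
  assumes "s \<in> C"
  shows "p *\<^sub>R mat 1 \<in> tangent_cone C s"
  using diff_in_tangent_cone[OF shift[OF assms], of p s] by simp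

text \<open>Both signs of the identity are tangent, so polarity becomes an equality.\<close>

lemma trace_normal_cone:
  assumes "s \<in> C" "\<eta> \<in> normal_cone C s"
  shows "trace \<eta> = 0"
proof -
  have "s \<in> Sym" using assms sub_Sym by auto
  have "p * trace \<eta> \<le> 0" for p
    using normal_cone_inner_le[OF \<open>s \<in> Sym\<close> assms(2) pressure_in_tangent_cone[OF assms(1), of p]]
    by (simp add: inner_mat_1)
  from this[of 1] this[of "-1"] show ?thesis by simp
qed

text \<open>The volumetric part is a multiple of the identity, hence orthogonal to trace-free
  normals.\<close>

lemma inner_elasticity_normal_cone:
  assumes "s \<in> C" "\<eta> \<in> normal_cone C s"
  shows "elasticity lam \<mu> x \<bullet> \<eta> = 2 * \<mu> * (x \<bullet> \<eta>)"
  using trace_normal_cone[OF assms] by (simp add: elasticity_def inner_add_left inner_mat_1)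

text \<open>Up to the factor \<open>2 * \<mu>\<close>, the operator only shifts \<open>x\<close>
  along the identity; that line lies in the cone with both signs, so the shift can be
  undone.\<close>

lemma elasticity_in_tangent_cone_iff:
  assumes "s \<in> C" "\<mu> > 0"
  shows "elasticity lam \<mu> x \<in> tangent_cone C s \<longleftrightarrow> x \<in> tangent_cone C s"
proof
  assume "x \<in> tangent_cone C s"
  then show "elasticity lam \<mu> x \<in> tangent_cone C s"
    unfolding elasticity_def using assms
    by (intro tangent_cone_add tangent_cone_scale pressure_in_tangent_cone) auto
next
  assume "elasticity lam \<mu> x \<in> tangent_cone C s"
  then have "elasticity lam \<mu> x + (- (lam * trace x)) *\<^sub>R mat 1 \<in> tangent_cone C s"
    by (intro tangent_cone_add pressure_in_tangent_cone assms)
  then have "(2 * \<mu>) *\<^sub>R x \<in> tangent_cone C s"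
    by (simp add: elasticity_def)
  then have "(1 / (2 * \<mu>)) *\<^sub>R ((2 * \<mu>) *\<^sub>R x) \<in> tangent_cone C s"
    by (rule tangent_cone_scale[rotated]) (use assms(2) in simp)
  also have "(1 / (2 * \<mu>)) *\<^sub>R ((2 * \<mu>) *\<^sub>R x) = x"
    using assms(2) by simp
  finally show "x \<in> tangent_cone C s" .
qed

lemma elasticity_add_normal:
  assumes "s \<in> C" "b \<in> normal_cone C s"
  shows "elasticity lam \<mu> (a + b) = elasticity lam \<mu> a + (2 * \<mu>) *\<^sub>R b"
  using trace_normal_cone[OF assms] by (simp add: elasticity_def trace_add algebra_simps)

text \<open>The images of \<open>a\<close> and \<open>b\<close> stay in their cones and stay
  orthogonal, so uniqueness of the decomposition identifies them as the projections.\<close>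

lemma moreau_elasticity:
  assumes "s \<in> C" "\<mu> > 0" "a \<in> tangent_cone C s" "b \<in> normal_cone C s" "a \<bullet> b = 0"
  shows "closest_point (tangent_cone C s) (elasticity lam \<mu> (a + b)) = elasticity lam \<mu> a"
    and "closest_point (normal_cone C s) (elasticity lam \<mu> (a + b)) = (2 * \<mu>) *\<^sub>R b"
proof -
  have "s \<in> Sym" using assms sub_Sym by auto
  have "elasticity lam \<mu> a \<bullet> (2 * \<mu>) *\<^sub>R b = 0"
    using inner_elasticity_normal_cone[OF assms(1,4)] assms(5) by simp
  from moreau_composition[OF \<open>s \<in> Sym\<close> _ _ this]
  show "closest_point (tangent_cone C s) (elasticity lam \<mu> (a + b)) = elasticity lam \<mu> a"
    and "closest_point (normal_cone C s) (elasticity lam \<mu> (a + b)) = (2 * \<mu>) *\<^sub>R b"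
    using assms \<open>s \<in> Sym\<close>
    by (auto simp: elasticity_in_tangent_cone_iff elasticity_add_normal normal_cone_scale)
qed

section \<open>Flow rules and Moreau decompositions\<close>

text \<open>The flow rules are conditional on these two cases, which must cover all of
  \<open>C\<close>.\<close>

lemma interior_or_frontier:
  assumes "s \<in> C"
  shows "s \<in> top_of_set Sym interior_of C \<or> s \<in> top_of_set Sym frontier_of C"
  using assms sub_Sym closure_of_subset[of C "top_of_set Sym"] by (auto simp: frontier_of_def)

text \<open>On the frontier maximum work is normality of \<open>dp\<close>; in the interior
  \<open>dp\<close> vanishes and is trivially normal. Hooke's law carries tangency of
  \<open>ds\<close> back to \<open>de\<close>, and turns consistency into orthogonality of
  \<open>de\<close> and \<open>dp\<close> after division by \<open>2 * \<mu>\<close>.\<close>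

lemma elastoplastic_rates:
  assumes "\<mu> > 0" "s \<in> C" "dp \<in> Sym" "ds \<in> tangent_cone C s" and hooke: "ds = elasticity lam \<mu> de"
    and elastic: "s \<in> top_of_set Sym interior_of C \<Longrightarrow> dp = 0"
    and work: "\<And>s'. s \<in> top_of_set Sym frontier_of C \<Longrightarrow> s' \<in> C \<Longrightarrow> dp \<bullet>\<bullet> s \<ge> dp \<bullet>\<bullet> s'"
    and consistency: "s \<in> top_of_set Sym frontier_of C \<Longrightarrow> dp \<bullet>\<bullet> ds = 0"
  shows "de \<in> tangent_cone C s" "dp \<in> normal_cone C s" "de \<bullet> dp = 0"
proof -
  have "s \<in> Sym" using assms sub_Sym by auto
  note inner = ddot_eq_inner[OF \<open>dp \<in> Sym\<close>]
  show "de \<in> tangent_cone C s"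
    using assms(1,2,4) by (simp add: hooke elasticity_in_tangent_cone_iff)
  have "(s' - s) \<bullet> dp \<le> 0" if "s' \<in> C" for s'
    using interior_or_frontier[OF \<open>s \<in> C\<close>] elastic work[OF _ that]
    by (auto simp: inner inner_diff_right inner_commute[of _ dp])
  with \<open>dp \<in> Sym\<close> show normal: "dp \<in> normal_cone C s"
    by (simp add: mem_normal_cone_iff[OF \<open>s \<in> Sym\<close>])
  have "ds \<bullet> dp = 0"
    using interior_or_frontier[OF \<open>s \<in> C\<close>] elastic consistency
    by (auto simp: inner inner_commute[of _ dp])
  then show "de \<bullet> dp = 0"
    using inner_elasticity_normal_cone[OF \<open>s \<in> C\<close> normal, of lam \<mu> de] \<open>\<mu> > 0\<close> by (simp add: hooke)
qed

end

theorem theorem2p1: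
  fixes C :: "mat3 set" and lam \<mu> T :: real
    and \<epsilon> \<epsilon>e \<epsilon>p \<sigma> :: "real \<Rightarrow> mat3"
  assumes "lam > 0" and "\<mu> > 0" and "T > 0"
    and "C \<subseteq> Sym" and "C \<noteq> {}" and "closed C" and "convex C"
    and "\<And>\<tau> p. \<tau> \<in> C \<Longrightarrow> \<tau> + p *\<^sub>R mat 1 \<in> C"
    and "\<epsilon> \<in> {0..<T} \<rightarrow> Sym" and "\<epsilon> differentiable_on {0..<T}"
    and "\<epsilon>e \<in> {0..<T} \<rightarrow> Sym" and "\<epsilon>e differentiable_on {0..<T}"
    and "\<epsilon>p \<in> {0..<T} \<rightarrow> Sym" and "\<epsilon>p differentiable_on {0..<T}"
    and "\<sigma> \<in> {0..<T} \<rightarrow> Sym" and "\<sigma> differentiable_on {0..<T}"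
  shows "(elastoplastic_laws C lam \<mu> T \<epsilon> \<epsilon>e \<epsilon>p \<sigma> \<longleftrightarrow> projection_laws C lam \<mu> T \<epsilon> \<epsilon>e \<epsilon>p \<sigma>) \<and>
    (elastoplastic_laws C lam \<mu> T \<epsilon> \<epsilon>e \<epsilon>p \<sigma> \<longrightarrow>
      (\<forall>t\<in>{0..<T}.
        time_deriv T \<sigma> t = elasticity lam \<mu> (time_deriv T \<epsilon> t)
          - (2 * \<mu>) *\<^sub>R closest_point (normal_cone C (\<sigma> t)) (time_deriv T \<epsilon> t) \<and>
        closest_point (normal_cone C (\<sigma> t)) (elasticity lam \<mu> (time_deriv T \<epsilon> t))
          = (2 * \<mu>) *\<^sub>R closest_point (normal_cone C (\<sigma> t)) (time_deriv T \<epsilon> t) \<and>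
        time_deriv T \<epsilon>e t \<bullet>\<bullet> time_deriv T \<epsilon>p t = 0 \<and>
        (norm (time_deriv T \<epsilon> t))\<^sup>2
          = (norm (time_deriv T \<epsilon>e t))\<^sup>2 + (norm (time_deriv T \<epsilon>p t))\<^sup>2))"
proof -
  interpret pressure_insensitive C
    using assms by unfold_locales auto
  note \<epsilon>_Sym = time_deriv_in_Sym[OF \<open>\<epsilon> \<in> {0..<T} \<rightarrow> Sym\<close> \<open>\<epsilon> differentiable_on {0..<T}\<close>]
  note \<epsilon>e_Sym = time_deriv_in_Sym[OF \<open>\<epsilon>e \<in> {0..<T} \<rightarrow> Sym\<close> \<open>\<epsilon>e differentiable_on {0..<T}\<close>]
  note \<epsilon>p_Sym = time_deriv_in_Sym[OF \<open>\<epsilon>p \<in> {0..<T} \<rightarrow> Sym\<close> \<open>\<epsilon>p differentiable_on {0..<T}\<close>]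
  \<comment> \<open>A common third form: an orthogonal splitting of the strain rate along the two
    cones, together with Hooke's law. Each system of laws is shown equivalent to it.\<close>
  define moreau_flow where "moreau_flow \<longleftrightarrow> (\<forall>t\<in>{0..<T}. \<sigma> t \<in> C \<and>
      time_deriv T \<epsilon> t = time_deriv T \<epsilon>e t + time_deriv T \<epsilon>p t \<and>
      time_deriv T \<epsilon>e t \<in> tangent_cone C (\<sigma> t) \<and> time_deriv T \<epsilon>p t \<in> normal_cone C (\<sigma> t) \<and>
      time_deriv T \<epsilon>e t \<bullet> time_deriv T \<epsilon>p t = 0 \<and>
      time_deriv T \<sigma> t = elasticity lam \<mu> (time_deriv T \<epsilon>e t))"
  have laws_flow: moreau_flow if laws: "elastoplastic_laws C lam \<mu> T \<epsilon> \<epsilon>e \<epsilon>p \<sigma>"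
    unfolding moreau_flow_def
  proof
    fix t assume t: "t \<in> {0..<T}"
    \<comment> \<open>The yield criterion at all times makes the stress rate tangential; the rest is
      pointwise in \<open>t\<close>.\<close>
    have "time_deriv T \<sigma> t \<in> tangent_cone C (\<sigma> t)"
      using laws t assms(16) by (intro time_deriv_in_tangent_cone) (auto simp: elastoplastic_laws_def)
    then show "\<sigma> t \<in> C \<and>
      time_deriv T \<epsilon> t = time_deriv T \<epsilon>e t + time_deriv T \<epsilon>p t \<and>
      time_deriv T \<epsilon>e t \<in> tangent_cone C (\<sigma> t) \<and> time_deriv T \<epsilon>p t \<in> normal_cone C (\<sigma> t) \<and>
      time_deriv T \<epsilon>e t \<bullet> time_deriv T \<epsilon>p t = 0 \<and>
      time_deriv T \<sigma> t = elasticity lam \<mu> (time_deriv T \<epsilon>e t)"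
      using elastoplastic_rates[of \<mu> "\<sigma> t" "time_deriv T \<epsilon>p t" "time_deriv T \<sigma> t" lam "time_deriv T \<epsilon>e t"]
        laws t \<open>\<mu> > 0\<close> \<epsilon>p_Sym[OF t]
      unfolding elastoplastic_laws_def by blast
  qed
  have flow_laws: "elastoplastic_laws C lam \<mu> T \<epsilon> \<epsilon>e \<epsilon>p \<sigma>" if moreau_flow
    unfolding elastoplastic_laws_def
  proof
    fix t assume t: "t \<in> {0..<T}"
    have *: "\<sigma> t \<in> C" "time_deriv T \<epsilon> t = time_deriv T \<epsilon>e t + time_deriv T \<epsilon>p t"
      "time_deriv T \<epsilon>p t \<in> normal_cone C (\<sigma> t)" "time_deriv T \<epsilon>e t \<bullet> time_deriv T \<epsilon>p t = 0"
      "time_deriv T \<sigma> t = elasticity lam \<mu> (time_deriv T \<epsilon>e t)"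
      using that t by (auto simp: moreau_flow_def)
    have "\<sigma> t \<in> Sym" using * sub_Sym by auto
    \<comment> \<open>Maximum work is the polarity inequality of the normal cone tested on
      \<open>\<sigma>' - \<sigma> t\<close>.\<close>
    have "time_deriv T \<epsilon>p t \<bullet>\<bullet> \<sigma>' \<le> time_deriv T \<epsilon>p t \<bullet>\<bullet> \<sigma> t" if "\<sigma>' \<in> C" for \<sigma>'
      using *(3) that unfolding mem_normal_cone_iff[OF \<open>\<sigma> t \<in> Sym\<close>]
      by (simp add: ddot_eq_inner inner_diff_left inner_commute[of "time_deriv T \<epsilon>p t"])
    moreover have "time_deriv T \<epsilon>p t \<bullet>\<bullet> time_deriv T \<sigma> t = 0"
      using inner_elasticity_normal_cone[OF *(1,3)] *(4,5)
      by (simp add: ddot_eq_inner[OF \<epsilon>p_Sym[OF t]] inner_commute[of "time_deriv T \<epsilon>p t"])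
    moreover have "time_deriv T \<epsilon>p t = 0" if "\<sigma> t \<in> top_of_set Sym interior_of C"
      using normal_cone_interior[OF that *(3)] .
    ultimately show "time_deriv T \<epsilon> t = time_deriv T \<epsilon>e t + time_deriv T \<epsilon>p t \<and>
      \<sigma> t \<in> C \<and> (\<sigma> t \<in> top_of_set Sym interior_of C \<longrightarrow> time_deriv T \<epsilon>p t = 0) \<and>
      time_deriv T \<sigma> t = elasticity lam \<mu> (time_deriv T \<epsilon>e t) \<and>
      (\<sigma> t \<in> top_of_set Sym frontier_of C \<longrightarrow>
        (\<forall>\<sigma>'\<in>C. time_deriv T \<epsilon>p t \<bullet>\<bullet> \<sigma> t \<ge> time_deriv T \<epsilon>p t \<bullet>\<bullet> \<sigma>')) \<and>
      (\<sigma> t \<in> top_of_set Sym frontier_of C \<longrightarrow> time_deriv T \<epsilon>p t \<bullet>\<bullet> time_deriv T \<sigma> t = 0)"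
      using * by blast
  qed
  have flow_rates: "closest_point (tangent_cone C (\<sigma> t)) (time_deriv T \<epsilon> t) = time_deriv T \<epsilon>e t"
      "closest_point (normal_cone C (\<sigma> t)) (time_deriv T \<epsilon> t) = time_deriv T \<epsilon>p t"
      "closest_point (tangent_cone C (\<sigma> t)) (elasticity lam \<mu> (time_deriv T \<epsilon> t)) = time_deriv T \<sigma> t"
      "closest_point (normal_cone C (\<sigma> t)) (elasticity lam \<mu> (time_deriv T \<epsilon> t))
        = (2 * \<mu>) *\<^sub>R time_deriv T \<epsilon>p t"
      "time_deriv T \<sigma> t = elasticity lam \<mu> (time_deriv T \<epsilon> t) - (2 * \<mu>) *\<^sub>R time_deriv T \<epsilon>p t"
      "(norm (time_deriv T \<epsilon> t))\<^sup>2 = (norm (time_deriv T \<epsilon>e t))\<^sup>2 + (norm (time_deriv T \<epsilon>p t))\<^sup>2"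
      "time_deriv T \<epsilon>e t \<bullet>\<bullet> time_deriv T \<epsilon>p t = 0"
    if moreau_flow "t \<in> {0..<T}" for t
  proof -
    have *: "\<sigma> t \<in> C" "time_deriv T \<epsilon> t = time_deriv T \<epsilon>e t + time_deriv T \<epsilon>p t"
      "time_deriv T \<epsilon>e t \<in> tangent_cone C (\<sigma> t)"
      "time_deriv T \<epsilon>p t \<in> normal_cone C (\<sigma> t)" "time_deriv T \<epsilon>e t \<bullet> time_deriv T \<epsilon>p t = 0"
      "time_deriv T \<sigma> t = elasticity lam \<mu> (time_deriv T \<epsilon>e t)"
      using that by (auto simp: moreau_flow_def)
    have "\<sigma> t \<in> Sym" using * sub_Sym by auto
    show "closest_point (tangent_cone C (\<sigma> t)) (time_deriv T \<epsilon> t) = time_deriv T \<epsilon>e t"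
      "closest_point (normal_cone C (\<sigma> t)) (time_deriv T \<epsilon> t) = time_deriv T \<epsilon>p t"
      using moreau_composition[OF \<open>\<sigma> t \<in> Sym\<close> *(3-5)] by (simp_all add: *(2))
    show "closest_point (tangent_cone C (\<sigma> t)) (elasticity lam \<mu> (time_deriv T \<epsilon> t)) = time_deriv T \<sigma> t"
      "closest_point (normal_cone C (\<sigma> t)) (elasticity lam \<mu> (time_deriv T \<epsilon> t))
        = (2 * \<mu>) *\<^sub>R time_deriv T \<epsilon>p t"
      using moreau_elasticity[OF *(1) \<open>\<mu> > 0\<close> *(3-5)] by (simp_all add: *(2,6))
    show "time_deriv T \<sigma> t = elasticity lam \<mu> (time_deriv T \<epsilon> t) - (2 * \<mu>) *\<^sub>R time_deriv T \<epsilon>p t"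
      by (simp add: *(2,6) elasticity_add_normal[OF *(1,4)])
    show "(norm (time_deriv T \<epsilon> t))\<^sup>2 = (norm (time_deriv T \<epsilon>e t))\<^sup>2 + (norm (time_deriv T \<epsilon>p t))\<^sup>2"
      using *(5) unfolding *(2)
      by (simp add: power2_norm_eq_inner inner_add_left inner_add_right inner_commute)
    show "time_deriv T \<epsilon>e t \<bullet>\<bullet> time_deriv T \<epsilon>p t = 0"
      using *(5) by (simp add: ddot_eq_inner[OF \<epsilon>e_Sym[OF that(2)]])
  qed
  \<comment> \<open>\<open>T > 0\<close> makes 0 a point of the interval, which yields the initial
    condition.\<close>
  have flow_projection: "projection_laws C lam \<mu> T \<epsilon> \<epsilon>e \<epsilon>p \<sigma>" if moreau_flow
    using that flow_rates[OF that] \<open>T > 0\<close> by (auto simp: projection_laws_def moreau_flow_def)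
  have projection_flow: moreau_flow if laws: "projection_laws C lam \<mu> T \<epsilon> \<epsilon>e \<epsilon>p \<sigma>"
    unfolding moreau_flow_def
  proof
    fix t assume t: "t \<in> {0..<T}"
    \<comment> \<open>This comes first because \<open>moreau_decomposition\<close> applies only at
      points of \<open>C\<close>, whereas a projection onto the tangent cone lies in that cone at
      any base point.\<close>
    have "\<sigma> t \<in> C"
    proof (rule viability[OF \<open>\<sigma> differentiable_on {0..<T}\<close> _ _ t])
      show "\<sigma> 0 \<in> C"
        using laws by (simp add: projection_laws_def)
      show "time_deriv T \<sigma> s \<in> tangent_cone C (\<sigma> s)" if "s \<in> {0..<T}" for s
        using laws that closest_point_in_set[OF closed_tangent_cone tangent_cone_nonempty]
        by (simp add: projection_laws_def)
    qed
    have "time_deriv T \<epsilon>e t = closest_point (tangent_cone C (\<sigma> t)) (time_deriv T \<epsilon> t)"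
      "time_deriv T \<epsilon>p t = closest_point (normal_cone C (\<sigma> t)) (time_deriv T \<epsilon> t)"
      using laws t by (auto simp: projection_laws_def)
    note rates = moreau_decomposition[OF \<open>\<sigma> t \<in> C\<close> \<epsilon>_Sym[OF t] this]
    \<comment> \<open>The tangential projection of the transformed strain rate is the transformed
      elastic rate, so the third projection law becomes Hooke's law.\<close>
    moreover have "time_deriv T \<sigma> t = elasticity lam \<mu> (time_deriv T \<epsilon>e t)"
      using laws t moreau_elasticity(1)[OF \<open>\<sigma> t \<in> C\<close> \<open>\<mu> > 0\<close> rates(2-4), of lam, folded rates(1)]
      by (simp add: projection_laws_def)
    ultimately show "\<sigma> t \<in> C \<and>
      time_deriv T \<epsilon> t = time_deriv T \<epsilon>e t + time_deriv T \<epsilon>p t \<and>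
      time_deriv T \<epsilon>e t \<in> tangent_cone C (\<sigma> t) \<and> time_deriv T \<epsilon>p t \<in> normal_cone C (\<sigma> t) \<and>
      time_deriv T \<epsilon>e t \<bullet> time_deriv T \<epsilon>p t = 0 \<and>
      time_deriv T \<sigma> t = elasticity lam \<mu> (time_deriv T \<epsilon>e t)"
      using \<open>\<sigma> t \<in> C\<close> by blast
  qed
  show ?thesis
  proof (intro conjI[OF _ impI] ballI)
    show "elastoplastic_laws C lam \<mu> T \<epsilon> \<epsilon>e \<epsilon>p \<sigma> \<longleftrightarrow> projection_laws C lam \<mu> T \<epsilon> \<epsilon>e \<epsilon>p \<sigma>"
      using laws_flow flow_laws flow_projection projection_flow by blast
  next
    fix t assume "elastoplastic_laws C lam \<mu> T \<epsilon> \<epsilon>e \<epsilon>p \<sigma>" and t: "t \<in> {0..<T}"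
    note rates = flow_rates[OF laws_flow[OF this(1)] t]
    show "time_deriv T \<sigma> t = elasticity lam \<mu> (time_deriv T \<epsilon> t)
          - (2 * \<mu>) *\<^sub>R closest_point (normal_cone C (\<sigma> t)) (time_deriv T \<epsilon> t) \<and>
        closest_point (normal_cone C (\<sigma> t)) (elasticity lam \<mu> (time_deriv T \<epsilon> t))
          = (2 * \<mu>) *\<^sub>R closest_point (normal_cone C (\<sigma> t)) (time_deriv T \<epsilon> t) \<and>
        time_deriv T \<epsilon>e t \<bullet>\<bullet> time_deriv T \<epsilon>p t = 0 \<and>
        (norm (time_deriv T \<epsilon> t))\<^sup>2
          = (norm (time_deriv T \<epsilon>e t))\<^sup>2 + (norm (time_deriv T \<epsilon>p t))\<^sup>2"
      unfolding rates(2) by (intro conjI rates)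
  qed
qed

end
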